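(* Let $D\ge 1$ and $N>2D$ be integers, let $q$ be a prime power, let $\Gamma=J_q(N,D)$, and let $x$ be a vertex of $\Gamma$. Let $W$ be an irreducible $T$-submodule of the nucleus $\mathcal{N}=\mathcal{N}(x)$ with endpoint $r$. Let $\Omega\subseteq\Psi$ be an irreducible $\mathcal{H}$-module that is alpha-dominant with gap $r$. Then the following are equivalent: (i) $\widetilde{\Omega}=W$; (ii) $\Omega=W^{\mathcal{H}}$.
   Context: Let $\mathbb{F}_q$ be a finite field with $q$ elements and $\mathcal{V}$ an $N$-dimensional vector space over $\mathbb{F}_q$. The Grassmann graph $\Gamma=J_q(N,D)$ has vertex set $X$ consisting of the $D$-dimensional subspaces of $\mathcal{V}$; $y,z\in X$ are adjacent iff $\dim(y\cap z)=D-1$. Let $\partial$ be the path-length distance; for $N>2D$ the diameter is $D$ and $\partial(y,z)=D-\dim(y\cap z)$. Put $[\ell]=\frac{q^\ell-1}{q-1}$. Terwilliger algebra and nucleus. Let $A\in\mathrm{Mat}_X(\mathbb{C})$ be the adjacency matrix of $\Gamma$ and $V=\mathbb{C}^X$. $A$ has exactly $D+1$ distinct eigenvalues $\theta_0>\cdots>\theta_D$, namely $\theta_i=q[D][N-D]-[i][N-i+1]$; let $E_i$ be the orthogonal projection of $V$ onto the $\theta_i$-eigenspace. For $0\le i\le D$ let $E_i^*$ be the diagonal matrix with $(y,y)$-entry $1$ if $\partial(x,y)=i$ and $0$ otherwise. $T=T(x)$ is the subalgebra of $\mathrm{Mat}_X(\mathbb{C})$ generated by $A,E_0^*,\dots,E_D^*$.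 A $T$-module is a subspace $W\subseteq V$ with $TW\subseteq W$; irreducible means nonzero with no $T$-submodule other than $0$ and $W$. An irreducible $T$-module $W$ has endpoint $r=\min\{i: E_i^*W\ne0\}$, dual endpoint $t=\min\{i: E_iW\neq 0\}$, diameter $d=|\{i: E_i^*W\ne 0\}|-1$, and displacement $r+t-D+d$. The nucleus $\mathcal{N}$ is the span of all irreducible $T$-modules with displacement $0$. The algebra $\mathcal{H}$. Let $P$ be the set of all subspaces of $\mathcal{V}$. For $0\le i\le D$, $0\le j\le N-D$ let $P_{i,j}=\{u\in P: \dim(u\cap x)=i,\ \dim u=i+j\}$; these sets partition $P$. For $u\subseteq v$ in $P$ with $\dim v=\dim u+1$ and $u\in P_{i,j}$: $v$ $/$-covers $u$ if $v\in P_{i+1,j}$, and $v$ $\backslash$-covers $u$ if $v\in P_{i,j+1}$ (exactly one holds). In $\mathrm{Mat}_P(\mathbb{C})$: $E^*_{i,j}$ is the diagonal projection onto coordinates in $P_{i,j}$; $K_1,K_2$ are diagonal with $(u,u)$-entries $q^{D/2-i}$, $q^{(N-D)/2-j}$ for $u\in P_{i,j}$; $L_1$ (resp. $L_2$) has $(u,v)$-entry $1$ if $v$ $/$-covers (resp. $\backslash$-covers) $u$ and $0$ otherwise; $R_1=L_1^\top$, $R_2=L_2^\top$. $\mathcal{H}=\mathcal{H}(x)$ is the subalgebra generated by $L_1,L_2,R_1,R_2,K_1^{\pm1},K_2^{\pm1}$. Let $\Psi=\mathbb{C}^P$; $\mathcal{H}$-modules are $\mathcal{H}$-invariant subspaces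 of $\Psi$, irreducible if nonzero with no $\mathcal{H}$-submodule other than $0$ and itself. For each irreducible $\mathcal{H}$-module $\Omega$ there are unique integers $\alpha,\beta,\rho$ with $\rho\ge0$, $0\le\alpha\le\frac{D-\rho}{2}$, $0\le\beta\le\frac{N-D-\rho}{2}$ such that for $0\le i\le D$, $0\le j\le N-D$, $\dim E^*_{i,j}\Omega=1$ if $\alpha\le i\le D-\rho-\alpha$ and $\rho+\beta\le j\le N-D-\beta$, and $\dim E^*_{i,j}\Omega=0$ otherwise. The triple $(\alpha,\beta,\rho)$ is the type of $\Omega$. $\Omega$ is alpha-dominant with gap $\alpha$ if it has type $(\alpha,0,0)$ with $0\le\alpha\le\frac D2$. Regard $V$ as the subspace $\sum_{j=0}^{D}E^*_{D-j,j}\Psi$ of $\Psi$ (vectors supported on $X\subseteq P$). For an $\mathcal{H}$-submodule $\Omega\subseteq\Psi$ let $\widetilde{\Omega}=\sum_{j=0}^{D}E^*_{D-j,j}\Omega\subseteq V$. For a $T$-module $W$, let $W^{\mathcal{H}}$ be the intersection of all $\mathcal{H}$-submodules $\Omega\subseteq\Psi$ with $\widetilde{\Omega}=W$. *)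

theory Defs
  imports "HOL-Analysis.Analysis" "HOL-Library.Set_Algebras"
begin

text \<open>
  The ambient \<open>N\<close>-dimensional vector space over \<open>\<bbbF>\<^sub>q\<close> is the type \<open>'v\<close> with scalar
  multiplication \<open>smul :: 'a \<Rightarrow> 'v \<Rightarrow> 'v\<close>, so \<open>q = CARD('a)\<close>; requiring \<open>'v\<close> to be a finite type
  is no restriction, as a finite-dimensional space over a finite field is finite.

  For a set \<open>S\<close> of subsets of \<open>'v\<close> (the subspaces, or the \<open>D\<close>-dimensional subspaces), the space
  \<open>\<complex>\<^sup>S\<close> is the set of vectors in \<open>complex ^ 'v set\<close> that vanish outside \<open>S\<close>, and \<open>Mat\<^sub>S(\<complex>)\<close> is
  the algebra of matrices that vanish outside \<open>S \<times> S\<close>; its identity is \<open>diag_on S (\<lambda>_. 1)\<close>.  Thus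
  \<open>V = \<complex>\<^sup>X\<close> is literally a subspace of \<open>\<Psi> = \<complex>\<^sup>P\<close>.
\<close>

type_synonym 'v cvec = "complex ^ ('v set)"
type_synonym 'v cmat = "complex ^ ('v set) ^ ('v set)"

definition supported_on :: "'v::finite set set \<Rightarrow> 'v cvec set" where
  "supported_on S = {f. \<forall>u. u \<notin> S \<longrightarrow> f $ u = 0}"

definition diag_on :: "'v::finite set set \<Rightarrow> ('v set \<Rightarrow> complex) \<Rightarrow> 'v cmat" where
  "diag_on S f = (\<chi> u v. if u = v \<and> u \<in> S then f u else 0)"

text \<open>The unital subalgebra of \<open>Mat\<^sub>S(\<complex>)\<close> generated by a set \<open>G\<close> of elements of \<open>Mat\<^sub>S(\<complex>)\<close>.\<close>

inductive_set generated_algebra ::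
  "'v::finite set set \<Rightarrow> 'v cmat set \<Rightarrow> 'v cmat set" for S G where
  one: "diag_on S (\<lambda>_. 1) \<in> generated_algebra S G"
| generator: "M \<in> G \<Longrightarrow> M \<in> generated_algebra S G"
| add: "M \<in> generated_algebra S G \<Longrightarrow> M' \<in> generated_algebra S G \<Longrightarrow>
    M + M' \<in> generated_algebra S G"
| mult: "M \<in> generated_algebra S G \<Longrightarrow> M' \<in> generated_algebra S G \<Longrightarrow>
    M ** M' \<in> generated_algebra S G"
| scale: "M \<in> generated_algebra S G \<Longrightarrow>
    (\<chi> u v. c * M $ u $ v) \<in> generated_algebra S G"

definition module_on :: "'v::finite set set \<Rightarrow> 'v cmat set \<Rightarrow> 'v cvec set \<Rightarrow> bool" where
  "module_on S \<A> W \<longleftrightarrow>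
     vec.subspace W \<and> W \<subseteq> supported_on S \<and> (\<forall>M\<in>\<A>. \<forall>w\<in>W. M *v w \<in> W)"

definition irreducible_module_on ::
  "'v::finite set set \<Rightarrow> 'v cmat set \<Rightarrow> 'v cvec set \<Rightarrow> bool" where
  "irreducible_module_on S \<A> W \<longleftrightarrow>
     module_on S \<A> W \<and> W \<noteq> {0} \<and>
     (\<forall>U. module_on S \<A> U \<and> U \<subseteq> W \<longrightarrow> U = {0} \<or> U = W)"


section \<open>The Grassmann graph and its Terwilliger algebra\<close>

definition vertices ::
  "('a::{field,finite} \<Rightarrow> 'v::{ab_group_add,finite} \<Rightarrow> 'v) \<Rightarrow> nat \<Rightarrow> 'v set set" where
  "vertices smul D = {y. module.subspace smul y \<and> vector_space.dim smul y = D}"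

definition adjacency_rel ::
  "('a::{field,finite} \<Rightarrow> 'v::{ab_group_add,finite} \<Rightarrow> 'v) \<Rightarrow> nat \<Rightarrow> ('v set \<times> 'v set) set" where
  "adjacency_rel smul D =
     {(y, z). y \<in> vertices smul D \<and> z \<in> vertices smul D \<and>
              vector_space.dim smul (y \<inter> z) = D - 1}"

definition graph_dist ::
  "('a::{field,finite} \<Rightarrow> 'v::{ab_group_add,finite} \<Rightarrow> 'v) \<Rightarrow> nat \<Rightarrow> 'v set \<Rightarrow> 'v set \<Rightarrow> nat" where
  "graph_dist smul D y z = (LEAST n. (y, z) \<in> adjacency_rel smul D ^^ n)"

definition adjacency_matrix ::
  "('a::{field,finite} \<Rightarrow> 'v::{ab_group_add,finite} \<Rightarrow> 'v) \<Rightarrow> nat \<Rightarrow> 'v cmat" where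
  "adjacency_matrix smul D = (\<chi> y z. if (y, z) \<in> adjacency_rel smul D then 1 else 0)"

definition dual_idempotent ::
  "('a::{field,finite} \<Rightarrow> 'v::{ab_group_add,finite} \<Rightarrow> 'v) \<Rightarrow> nat \<Rightarrow> 'v set \<Rightarrow> nat \<Rightarrow> 'v cmat" where
  "dual_idempotent smul D x i =
     diag_on (vertices smul D) (\<lambda>y. if graph_dist smul D x y = i then 1 else 0)"

definition qbracket :: "nat \<Rightarrow> nat \<Rightarrow> real" where
  "qbracket q l = (real q ^ l - 1) / (real q - 1)"

definition grassmann_eigenvalue :: "nat \<Rightarrow> nat \<Rightarrow> nat \<Rightarrow> nat \<Rightarrow> real" where
  "grassmann_eigenvalue q N D i =
     real q * qbracket q D * qbracket q (N - D) - qbracket q i * qbracket q (N - i + 1)"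

definition eigenspace ::
  "('a::{field,finite} \<Rightarrow> 'v::{ab_group_add,finite} \<Rightarrow> 'v) \<Rightarrow> nat \<Rightarrow> nat \<Rightarrow> nat \<Rightarrow> 'v cvec set" where
  "eigenspace smul N D i =
     {v \<in> supported_on (vertices smul D).
        adjacency_matrix smul D *v v =
          complex_of_real (grassmann_eigenvalue CARD('a) N D i) *s v}"

definition hermitian_inner :: "'v::finite cvec \<Rightarrow> 'v cvec \<Rightarrow> complex" where
  "hermitian_inner v w = (\<Sum>u\<in>UNIV. v $ u * cnj (w $ u))"

definition orthogonal_projection :: "'v::finite cvec set \<Rightarrow> 'v cvec \<Rightarrow> 'v cvec" where
  "orthogonal_projection U v = (THE w. w \<in> U \<and> (\<forall>z\<in>U. hermitian_inner (v - w) z = 0))"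

definition primitive_idempotent ::
  "('a::{field,finite} \<Rightarrow> 'v::{ab_group_add,finite} \<Rightarrow> 'v) \<Rightarrow> nat \<Rightarrow> nat \<Rightarrow> nat
     \<Rightarrow> 'v cvec \<Rightarrow> 'v cvec" where
  "primitive_idempotent smul N D i = orthogonal_projection (eigenspace smul N D i)"

definition T_algebra ::
  "('a::{field,finite} \<Rightarrow> 'v::{ab_group_add,finite} \<Rightarrow> 'v) \<Rightarrow> nat \<Rightarrow> 'v set \<Rightarrow> 'v cmat set" where
  "T_algebra smul D x =
     generated_algebra (vertices smul D)
       (insert (adjacency_matrix smul D) (dual_idempotent smul D x ` {0..D}))"

definition irreducible_T_module ::
  "('a::{field,finite} \<Rightarrow> 'v::{ab_group_add,finite} \<Rightarrow> 'v) \<Rightarrow> nat \<Rightarrow> 'v set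
     \<Rightarrow> 'v cvec set \<Rightarrow> bool" where
  "irreducible_T_module smul D x W \<longleftrightarrow>
     irreducible_module_on (vertices smul D) (T_algebra smul D x) W"

definition module_support ::
  "('a::{field,finite} \<Rightarrow> 'v::{ab_group_add,finite} \<Rightarrow> 'v) \<Rightarrow> nat \<Rightarrow> 'v set
     \<Rightarrow> 'v cvec set \<Rightarrow> nat set" where
  "module_support smul D x W = {i. i \<le> D \<and> (*v) (dual_idempotent smul D x i) ` W \<noteq> {0}}"

definition dual_support ::
  "('a::{field,finite} \<Rightarrow> 'v::{ab_group_add,finite} \<Rightarrow> 'v) \<Rightarrow> nat \<Rightarrow> nat
     \<Rightarrow> 'v cvec set \<Rightarrow> nat set" where
  "dual_support smul N D W = {i. i \<le> D \<and> primitive_idempotent smul N D i ` W \<noteq> {0}}"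

definition endpoint ::
  "('a::{field,finite} \<Rightarrow> 'v::{ab_group_add,finite} \<Rightarrow> 'v) \<Rightarrow> nat \<Rightarrow> 'v set
     \<Rightarrow> 'v cvec set \<Rightarrow> nat" where
  "endpoint smul D x W = Min (module_support smul D x W)"

definition dual_endpoint ::
  "('a::{field,finite} \<Rightarrow> 'v::{ab_group_add,finite} \<Rightarrow> 'v) \<Rightarrow> nat \<Rightarrow> nat
     \<Rightarrow> 'v cvec set \<Rightarrow> nat" where
  "dual_endpoint smul N D W = Min (dual_support smul N D W)"

definition module_diameter ::
  "('a::{field,finite} \<Rightarrow> 'v::{ab_group_add,finite} \<Rightarrow> 'v) \<Rightarrow> nat \<Rightarrow> 'v set
     \<Rightarrow> 'v cvec set \<Rightarrow> int" where
  "module_diameter smul D x W = int (card (module_support smul D x W)) - 1"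

definition displacement ::
  "('a::{field,finite} \<Rightarrow> 'v::{ab_group_add,finite} \<Rightarrow> 'v) \<Rightarrow> nat \<Rightarrow> nat \<Rightarrow> 'v set
     \<Rightarrow> 'v cvec set \<Rightarrow> int" where
  "displacement smul N D x W =
     int (endpoint smul D x W) + int (dual_endpoint smul N D W) - int D
       + module_diameter smul D x W"

definition nucleus ::
  "('a::{field,finite} \<Rightarrow> 'v::{ab_group_add,finite} \<Rightarrow> 'v) \<Rightarrow> nat \<Rightarrow> nat \<Rightarrow> 'v set
     \<Rightarrow> 'v cvec set" where
  "nucleus smul N D x =
     vec.span (\<Union>{W. irreducible_T_module smul D x W \<and> displacement smul N D x W = 0})"


section \<open>The algebra \<open>\<H>\<close> on all subspaces\<close>

definition subspaces ::
  "('a::{field,finite} \<Rightarrow> 'v::{ab_group_add,finite} \<Rightarrow> 'v) \<Rightarrow> 'v set set" where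
  "subspaces smul = {u. module.subspace smul u}"

definition location_class ::
  "('a::{field,finite} \<Rightarrow> 'v::{ab_group_add,finite} \<Rightarrow> 'v) \<Rightarrow> 'v set \<Rightarrow> nat \<Rightarrow> nat
     \<Rightarrow> 'v set set" where
  "location_class smul x i j =
     {u \<in> subspaces smul. vector_space.dim smul (u \<inter> x) = i \<and> vector_space.dim smul u = i + j}"

definition slash_covers ::
  "('a::{field,finite} \<Rightarrow> 'v::{ab_group_add,finite} \<Rightarrow> 'v) \<Rightarrow> 'v set \<Rightarrow> 'v set \<Rightarrow> 'v set \<Rightarrow> bool" where
  "slash_covers smul x v u \<longleftrightarrow>
     u \<subseteq> v \<and> vector_space.dim smul v = vector_space.dim smul u + 1 \<and>
     (\<exists>i j. u \<in> location_class smul x i j \<and> v \<in> location_class smul x (i + 1) j)"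

definition backslash_covers ::
  "('a::{field,finite} \<Rightarrow> 'v::{ab_group_add,finite} \<Rightarrow> 'v) \<Rightarrow> 'v set \<Rightarrow> 'v set \<Rightarrow> 'v set \<Rightarrow> bool" where
  "backslash_covers smul x v u \<longleftrightarrow>
     u \<subseteq> v \<and> vector_space.dim smul v = vector_space.dim smul u + 1 \<and>
     (\<exists>i j. u \<in> location_class smul x i j \<and> v \<in> location_class smul x i (j + 1))"

definition E_star ::
  "('a::{field,finite} \<Rightarrow> 'v::{ab_group_add,finite} \<Rightarrow> 'v) \<Rightarrow> 'v set \<Rightarrow> nat \<Rightarrow> nat \<Rightarrow> 'v cmat" where
  "E_star smul x i j = diag_on (location_class smul x i j) (\<lambda>_. 1)"

definition L1 ::
  "('a::{field,finite} \<Rightarrow> 'v::{ab_group_add,finite} \<Rightarrow> 'v) \<Rightarrow> 'v set \<Rightarrow> 'v cmat" where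
  "L1 smul x = (\<chi> u v. if slash_covers smul x v u then 1 else 0)"

definition L2 ::
  "('a::{field,finite} \<Rightarrow> 'v::{ab_group_add,finite} \<Rightarrow> 'v) \<Rightarrow> 'v set \<Rightarrow> 'v cmat" where
  "L2 smul x = (\<chi> u v. if backslash_covers smul x v u then 1 else 0)"

definition R1 ::
  "('a::{field,finite} \<Rightarrow> 'v::{ab_group_add,finite} \<Rightarrow> 'v) \<Rightarrow> 'v set \<Rightarrow> 'v cmat" where
  "R1 smul x = transpose (L1 smul x)"

definition R2 ::
  "('a::{field,finite} \<Rightarrow> 'v::{ab_group_add,finite} \<Rightarrow> 'v) \<Rightarrow> 'v set \<Rightarrow> 'v cmat" where
  "R2 smul x = transpose (L2 smul x)"

text \<open>For \<open>u\<close> in \<open>location_class smul x i j\<close>, \<open>i = dim (u \<inter> x)\<close> and \<open>j = dim u - dim (u \<inter> x)\<close>.\<close>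

definition k1 ::
  "('a::{field,finite} \<Rightarrow> 'v::{ab_group_add,finite} \<Rightarrow> 'v) \<Rightarrow> nat \<Rightarrow> 'v set \<Rightarrow> 'v set \<Rightarrow> real" where
  "k1 smul D x u =
     real CARD('a) powr (real D / 2 - real (vector_space.dim smul (u \<inter> x)))"

definition k2 ::
  "('a::{field,finite} \<Rightarrow> 'v::{ab_group_add,finite} \<Rightarrow> 'v) \<Rightarrow> nat \<Rightarrow> nat \<Rightarrow> 'v set \<Rightarrow> 'v set
     \<Rightarrow> real" where
  "k2 smul N D x u =
     real CARD('a) powr ((real N - real D) / 2
       - (real (vector_space.dim smul u) - real (vector_space.dim smul (u \<inter> x))))"

definition K1 ::
  "('a::{field,finite} \<Rightarrow> 'v::{ab_group_add,finite} \<Rightarrow> 'v) \<Rightarrow> nat \<Rightarrow> 'v set \<Rightarrow> 'v cmat" where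
  "K1 smul D x = diag_on (subspaces smul) (\<lambda>u. complex_of_real (k1 smul D x u))"

definition K1_inv ::
  "('a::{field,finite} \<Rightarrow> 'v::{ab_group_add,finite} \<Rightarrow> 'v) \<Rightarrow> nat \<Rightarrow> 'v set \<Rightarrow> 'v cmat" where
  "K1_inv smul D x = diag_on (subspaces smul) (\<lambda>u. complex_of_real (inverse (k1 smul D x u)))"

definition K2 ::
  "('a::{field,finite} \<Rightarrow> 'v::{ab_group_add,finite} \<Rightarrow> 'v) \<Rightarrow> nat \<Rightarrow> nat \<Rightarrow> 'v set \<Rightarrow> 'v cmat" where
  "K2 smul N D x = diag_on (subspaces smul) (\<lambda>u. complex_of_real (k2 smul N D x u))"

definition K2_inv ::
  "('a::{field,finite} \<Rightarrow> 'v::{ab_group_add,finite} \<Rightarrow> 'v) \<Rightarrow> nat \<Rightarrow> nat \<Rightarrow> 'v set \<Rightarrow> 'v cmat" where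
  "K2_inv smul N D x =
     diag_on (subspaces smul) (\<lambda>u. complex_of_real (inverse (k2 smul N D x u)))"

definition H_algebra ::
  "('a::{field,finite} \<Rightarrow> 'v::{ab_group_add,finite} \<Rightarrow> 'v) \<Rightarrow> nat \<Rightarrow> nat \<Rightarrow> 'v set
     \<Rightarrow> 'v cmat set" where
  "H_algebra smul N D x =
     generated_algebra (subspaces smul)
       {L1 smul x, L2 smul x, R1 smul x, R2 smul x,
        K1 smul D x, K1_inv smul D x, K2 smul N D x, K2_inv smul N D x}"

definition H_module ::
  "('a::{field,finite} \<Rightarrow> 'v::{ab_group_add,finite} \<Rightarrow> 'v) \<Rightarrow> nat \<Rightarrow> nat \<Rightarrow> 'v set
     \<Rightarrow> 'v cvec set \<Rightarrow> bool" where
  "H_module smul N D x \<Omega> \<longleftrightarrow> module_on (subspaces smul) (H_algebra smul N D x) \<Omega>"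

definition irreducible_H_module ::
  "('a::{field,finite} \<Rightarrow> 'v::{ab_group_add,finite} \<Rightarrow> 'v) \<Rightarrow> nat \<Rightarrow> nat \<Rightarrow> 'v set
     \<Rightarrow> 'v cvec set \<Rightarrow> bool" where
  "irreducible_H_module smul N D x \<Omega> \<longleftrightarrow>
     irreducible_module_on (subspaces smul) (H_algebra smul N D x) \<Omega>"

text \<open>
  \<open>has_type smul N D x \<Omega> \<alpha> \<beta> \<rho>\<close>: the irreducible \<open>\<H>\<close>-module \<open>\<Omega>\<close> has type \<open>(\<alpha>, \<beta>, \<rho>)\<close>.
  The bounds are written additively to avoid truncated subtraction on \<open>nat\<close>.
\<close>

definition has_type ::
  "('a::{field,finite} \<Rightarrow> 'v::{ab_group_add,finite} \<Rightarrow> 'v) \<Rightarrow> nat \<Rightarrow> nat \<Rightarrow> 'v set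
     \<Rightarrow> 'v cvec set \<Rightarrow> nat \<Rightarrow> nat \<Rightarrow> nat \<Rightarrow> bool" where
  "has_type smul N D x \<Omega> \<alpha> \<beta> \<rho> \<longleftrightarrow>
     2 * \<alpha> + \<rho> \<le> D \<and> D + 2 * \<beta> + \<rho> \<le> N \<and>
     (\<forall>i j. i \<le> D \<and> D + j \<le> N \<longrightarrow>
        vec.dim ((*v) (E_star smul x i j) ` \<Omega>) =
          (if \<alpha> \<le> i \<and> i + \<rho> + \<alpha> \<le> D \<and> \<rho> + \<beta> \<le> j \<and> D + j + \<beta> \<le> N then 1 else 0))"

definition alpha_dominant ::
  "('a::{field,finite} \<Rightarrow> 'v::{ab_group_add,finite} \<Rightarrow> 'v) \<Rightarrow> nat \<Rightarrow> nat \<Rightarrow> 'v set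
     \<Rightarrow> 'v cvec set \<Rightarrow> nat \<Rightarrow> bool" where
  "alpha_dominant smul N D x \<Omega> gap \<longleftrightarrow>
     irreducible_H_module smul N D x \<Omega> \<and> has_type smul N D x \<Omega> gap 0 0"

text \<open>The sum of subspaces is the elementwise sum of sets from \<open>HOL-Library.Set_Algebras\<close>.\<close>

definition tilde ::
  "('a::{field,finite} \<Rightarrow> 'v::{ab_group_add,finite} \<Rightarrow> 'v) \<Rightarrow> nat \<Rightarrow> 'v set
     \<Rightarrow> 'v cvec set \<Rightarrow> 'v cvec set" where
  "tilde smul D x \<Omega> = (\<Sum>j=0..D. (*v) (E_star smul x (D - j) j) ` \<Omega>)"

text \<open>The intersection is taken inside \<open>\<Psi>\<close>, so over an empty family it would be \<open>\<Psi>\<close>.\<close>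

definition H_hull ::
  "('a::{field,finite} \<Rightarrow> 'v::{ab_group_add,finite} \<Rightarrow> 'v) \<Rightarrow> nat \<Rightarrow> nat \<Rightarrow> 'v set
     \<Rightarrow> 'v cvec set \<Rightarrow> 'v cvec set" where
  "H_hull smul N D x W =
     supported_on (subspaces smul) \<inter> \<Inter>{\<Omega>. H_module smul N D x \<Omega> \<and> tilde smul D x \<Omega> = W}"

end

theory Submission
  imports Defs
begin

text \<open>
  Every \<open>\<H>\<close>-module \<open>\<Omega>\<close> is stable under the projections \<open>E\<^sup>*\<^sub>i\<^sub>j\<close>, which are polynomials in
  \<open>K\<^sub>1\<close> and \<open>K\<^sub>2\<close>, so it contains \<open>W\<close> as soon as its tilde is \<open>W\<close>.  Two \<open>\<H>\<close>-modules with tilde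
  \<open>W\<close> therefore meet nontrivially, and an irreducible one lies in every other.  Conversely, if an
  irreducible \<open>\<Omega>\<close> is the hull of \<open>W\<close>, then the hull is taken over a nonempty family: otherwise
  \<open>\<Omega> = \<Psi>\<close>, whereas \<open>E\<^sup>*\<^sub>0\<^sub>1\<Psi>\<close> has dimension at least 2 and \<open>E\<^sup>*\<^sub>0\<^sub>1\<Omega>\<close> at most 1.  Since \<open>W\<close> lies in
  every member of the family and tilde is monotone, the tilde of \<open>\<Omega>\<close> is \<open>W\<close>.
\<close>

lemma diag_on_mult_vec: "(diag_on S f *v w) $ u = (if u \<in> S then f u * w $ u else 0)"
proof -
  have "(diag_on S f *v w) $ u = (\<Sum>v\<in>UNIV. if v = u then (if u \<in> S then f u * w $ u else 0) else 0)"
    unfolding matrix_vector_mult_def diag_on_def vec_lambda_beta by (intro sum.cong) auto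
  then show ?thesis by simp
qed

lemma module_on_Int:
  "module_on S A U \<Longrightarrow> module_on S A U' \<Longrightarrow> module_on S A (U \<inter> U')"
  unfolding module_on_def by (auto intro: vec.subspace_inter)

text \<open>The spectral projection is the Lagrange interpolation polynomial of the diagonal matrix.\<close>

lemma diag_eigenprojection_invariant:
  fixes U :: "'v::finite cvec set"
  assumes U: "vec.subspace U" "U \<subseteq> supported_on S"
    and inv: "\<And>w. w \<in> U \<Longrightarrow> diag_on S f *v w \<in> U"
    and w: "w \<in> U"
  shows "(\<chi> u. if f u = c then w $ u else 0) \<in> U"
proof -
  have poly: "(\<chi> u. (\<Prod>c'\<in>C. (f u - c') / (c - c')) * w $ u) \<in> U"
    if "finite C" "c \<notin> C" for C
    using that
  proof (induction C rule: finite_induct)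
    case empty
    then show ?case using w by (simp add: vec_lambda_eta)
  next
    case (insert c' C)
    define z where "z = (\<chi> u. (\<Prod>c'\<in>C. (f u - c') / (c - c')) * w $ u)"
    have z: "z \<in> U" unfolding z_def using insert by simp
    have "(1 / (c - c')) *s (diag_on S f *v z - c' *s z) \<in> U"
      using U(1) inv z by (simp add: vec.subspace_scale vec.subspace_diff)
    moreover have "(1 / (c - c')) *s (diag_on S f *v z - c' *s z)
        = (\<chi> u. (\<Prod>c'\<in>insert c' C. (f u - c') / (c - c')) * w $ u)"
    proof (rule vec_eq_iff[THEN iffD2], rule allI)
      fix u
      show "((1 / (c - c')) *s (diag_on S f *v z - c' *s z)) $ u
          = (\<chi> u. (\<Prod>c'\<in>insert c' C. (f u - c') / (c - c')) * w $ u) $ u"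
      proof (cases "u \<in> S")
        case True
        then have "((1 / (c - c')) *s (diag_on S f *v z - c' *s z)) $ u
            = (1 / (c - c')) * (f u * z $ u - c' * z $ u)"
          by (simp add: diag_on_mult_vec diff_divide_distrib)
        also have "\<dots> = ((f u - c') / (c - c')) * z $ u"
          by (simp add: algebra_simps diff_divide_distrib)
        finally show ?thesis using insert.hyps by (simp add: z_def)
      next
        case False
        \<comment> \<open>Off \<open>S\<close> the matrix acts as 0 rather than as
          \<open>f u\<close>, so the two sides agree there only because \<open>w\<close>
          vanishes.\<close>
        then have "w $ u = 0" using U(2) w by (auto simp: supported_on_def)
        then show ?thesis using False by (simp add: diag_on_mult_vec z_def)
      qed
    qed
    ultimately show ?case by simp
  qed
  \<comment> \<open>If \<open>f u\<close> differs from \<open>c\<close>, it is itself one of the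
    nodes and contributes a zero factor; otherwise every factor is 1.\<close>
  have "(\<Prod>c'\<in>range f - {c}. (f u - c') / (c - c')) = (if f u = c then 1 else 0)" for u
    by (auto intro!: prod.neutral bexI[of _ "f u"])
  then have "(\<chi> u. (\<Prod>c'\<in>range f - {c}. (f u - c') / (c - c')) * w $ u)
      = (\<chi> u. if f u = c then w $ u else 0)"
    by (simp add: vec_eq_iff)
  with poly[of "range f - {c}"] show ?thesis by simp
qed

context
  fixes smul :: "'a::{field,finite} \<Rightarrow> 'v::{ab_group_add,finite} \<Rightarrow> 'v"
begin

lemma real_card_field_gt_1: "real CARD('a) > 1"
proof -
  have "card {0, 1::'a} \<le> CARD('a)" by (intro card_mono) auto
  then show ?thesis by simp
qed

text \<open>The classes \<open>location_class smul x i j\<close> are the joint eigenspaces of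
  \<open>K1\<close> and \<open>K2\<close>: since q > 1, the powers of q determine the exponents,
  hence i and j. Applying the two spectral projections in turn therefore gives
  \<open>E_star\<close>.\<close>

lemma H_module_E_star:
  assumes "H_module smul N D x \<Omega>" "w \<in> \<Omega>"
  shows "E_star smul x i j *v w \<in> \<Omega>"
proof -
  have sub: "vec.subspace \<Omega>" "\<Omega> \<subseteq> supported_on (subspaces smul)"
    and inv: "\<And>M w. M \<in> H_algebra smul N D x \<Longrightarrow> w \<in> \<Omega> \<Longrightarrow> M *v w \<in> \<Omega>"
    using assms(1) by (auto simp: H_module_def module_on_def)
  have "K1 smul D x \<in> H_algebra smul N D x" "K2 smul N D x \<in> H_algebra smul N D x"
    unfolding H_algebra_def by (auto intro: generated_algebra.generator)
  then have K: "K1 smul D x *v z \<in> \<Omega>" "K2 smul N D x *v z \<in> \<Omega>" if "z \<in> \<Omega>" for z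
    using inv that by auto
  let ?q = "real CARD('a)"
  define c1 where "c1 = complex_of_real (?q powr (real D / 2 - real i))"
  define c2 where "c2 = complex_of_real (?q powr ((real N - real D) / 2 - real j))"
  define w1 where "w1 = (\<chi> u. if complex_of_real (k1 smul D x u) = c1 then w $ u else 0)"
  define w2 where "w2 = (\<chi> u. if complex_of_real (k2 smul N D x u) = c2 then w1 $ u else 0)"
  have "w1 \<in> \<Omega>" unfolding w1_def
    using K(1) by (intro diag_eigenprojection_invariant[OF sub _ assms(2)]) (auto simp: K1_def)
  then have w2: "w2 \<in> \<Omega>" unfolding w2_def
    using K(2) by (intro diag_eigenprojection_invariant[OF sub]) (auto simp: K2_def)
  have "complex_of_real (k1 smul D x u) = c1 \<longleftrightarrow> vector_space.dim smul (u \<inter> x) = i" for u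
    using real_card_field_gt_1 by (simp add: c1_def k1_def powr_inj)
  moreover have "complex_of_real (k2 smul N D x u) = c2
      \<longleftrightarrow> real (vector_space.dim smul u) - real (vector_space.dim smul (u \<inter> x)) = real j" for u
    using real_card_field_gt_1 by (auto simp: c2_def k2_def powr_inj)
  ultimately have "E_star smul x i j *v w = w2"
    using sub(2) assms(2)
    by (auto simp: vec_eq_iff w1_def w2_def E_star_def diag_on_mult_vec location_class_def
        supported_on_def)
  with w2 show ?thesis by simp
qed

lemma mem_tilde_iff:
  "w \<in> tilde smul D x \<Omega> \<longleftrightarrow>
     (\<exists>a. w = (\<Sum>j=0..D. E_star smul x (D - j) j *v a j) \<and> (\<forall>j\<in>{0..D}. a j \<in> \<Omega>))"
proof
  assume "w \<in> tilde smul D x \<Omega>"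
  then obtain b where b: "w = (\<Sum>j=0..D. b j)"
      "\<forall>j\<in>{0..D}. b j \<in> (*v) (E_star smul x (D - j) j) ` \<Omega>"
    by (auto simp: tilde_def set_sum_alt)
  then obtain a where "\<forall>j\<in>{0..D}. b j = E_star smul x (D - j) j *v a j \<and> a j \<in> \<Omega>"
    unfolding image_iff Bex_def by metis
  with b show "\<exists>a. w = (\<Sum>j=0..D. E_star smul x (D - j) j *v a j) \<and> (\<forall>j\<in>{0..D}. a j \<in> \<Omega>)"
    by (intro exI[of _ a]) auto
qed (unfold tilde_def, auto simp: set_sum_alt)

lemma tilde_mono: "\<Omega> \<subseteq> \<Omega>' \<Longrightarrow> tilde smul D x \<Omega> \<subseteq> tilde smul D x \<Omega>'"
  by (auto simp: subset_iff mem_tilde_iff)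

lemma tilde_subset:
  assumes "H_module smul N D x \<Omega>"
  shows "tilde smul D x \<Omega> \<subseteq> \<Omega>"
proof
  fix w assume "w \<in> tilde smul D x \<Omega>"
  moreover have "vec.subspace \<Omega>" using assms by (simp add: H_module_def module_on_def)
  ultimately show "w \<in> \<Omega>"
    by (auto simp: mem_tilde_iff intro!: vec.subspace_sum H_module_E_star[OF assms])
qed

text \<open>Each vertex lies in exactly one class (D - j, j) with j \<le> D, so the projections
  defining \<open>tilde\<close> sum to the identity on vectors supported on the vertices. Hence
  \<open>w\<close> is the sum of its own components.\<close>

lemma subset_tilde:
  assumes "vector_space smul" and x: "x \<in> vertices smul D"
    and W: "W \<subseteq> supported_on (vertices smul D)" "W \<subseteq> \<Omega>"
  shows "W \<subseteq> tilde smul D x \<Omega>"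
proof
  interpret vector_space smul by fact
  interpret finite_dimensional_vector_space smul "extend_basis {}"
    by standard (auto simp: independent_extend_basis independent_empty span_extend_basis)
  fix w assume w: "w \<in> W"
  have "w $ u = (\<Sum>j=0..D. (E_star smul x (D - j) j *v w) $ u)" for u
  proof (cases "u \<in> vertices smul D")
    case True
    \<comment> \<open>This bound keeps \<open>D - dim (u \<inter> x)\<close> free of truncation, so
      it is the unique index j of the class of \<open>u\<close>.\<close>
    have "dim (u \<inter> x) \<le> D"
      using dim_subset[of "u \<inter> x" u] True by (simp add: vertices_def)
    then have loc: "u \<in> location_class smul x (D - j) j \<longleftrightarrow> j = D - dim (u \<inter> x)"
      if "j \<le> D" for j
      using True that by (auto simp: location_class_def subspaces_def vertices_def)
    have "(\<Sum>j=0..D. (E_star smul x (D - j) j *v w) $ u)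
        = (\<Sum>j=0..D. if j = D - dim (u \<inter> x) then w $ u else 0)"
      by (rule sum.cong) (auto simp: E_star_def diag_on_mult_vec loc)
    then show ?thesis by simp
  next
    case False
    then have "w $ u = 0" using W(1) w by (auto simp: supported_on_def)
    then show ?thesis by (simp add: E_star_def diag_on_mult_vec cong: if_cong)
  qed
  then have "w = (\<Sum>j=0..D. E_star smul x (D - j) j *v w)"
    by (simp add: vec_eq_iff)
  then show "w \<in> tilde smul D x \<Omega>"
    using w W(2) by (auto simp: mem_tilde_iff)
qed

text \<open>A line spanned by a vector outside \<open>x\<close> meets \<open>x\<close> only in 0.
  Two such lines come from v and v + y, with v outside \<open>x\<close> (as D < N) and y nonzero in
  \<open>x\<close> (as D \<ge> 1).\<close>

lemma two_points_outside_vertex: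
  assumes "vector_space smul" and N: "vector_space.dim smul (UNIV :: 'v set) = N"
    and D: "D \<ge> 1" "N > D" and x: "x \<in> vertices smul D"
  obtains u u' where "u \<noteq> u'" "u \<in> location_class smul x 0 1" "u' \<in> location_class smul x 0 1"
proof -
  interpret vector_space smul by fact
  have sx: "subspace x" and dx: "dim x = D" using x by (auto simp: vertices_def)
  have dim_zero: "dim {0} = 0"
    using dim_span[of "{}"] dim_eq_card_independent[OF independent_empty] by simp
  have line: "span {v} \<in> location_class smul x 0 1" if v: "v \<notin> x" for v
  proof -
    have "v \<noteq> 0" using v sx subspace_0 by blast
    then have "dim (span {v}) = 1" by (simp add: dim_eq_card_independent)
    moreover have "span {v} \<inter> x = {0}"
    proof -
      have "k = 0" if "smul k v \<in> x" for k
      proof (rule ccontr)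
        assume "k \<noteq> 0"
        then have "smul (inverse k) (smul k v) = v" by simp
        with subspace_scale[OF sx that, of "inverse k"] v show False by simp
      qed
      then show ?thesis using sx by (auto simp: span_singleton subspace_0 intro: image_eqI[of _ _ 0])
    qed
    ultimately show ?thesis
      by (simp add: location_class_def subspaces_def dim_zero)
  qed
  have "x \<noteq> UNIV" using dx N D by auto
  then obtain v where v: "v \<notin> x" by auto
  have "x \<noteq> {0}" using dx D dim_zero by auto
  then obtain y where y: "y \<in> x" "y \<noteq> 0" using subspace_0[OF sx] by auto
  have vy: "v + y \<notin> x" using v y subspace_diff[OF sx, of "v + y" y] by auto
  \<comment> \<open>Equal lines would make y a nonzero multiple of v, forcing v into
    \<open>x\<close>.\<close>
  have "span {v} \<noteq> span {v + y}"
  proof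
    assume "span {v} = span {v + y}"
    then have "v + y \<in> span {v}" using span_base[of "v + y" "{v + y}"] by simp
    then have "(v + y) - v \<in> span {v}" by (intro span_diff) (auto intro: span_base)
    then obtain k where k: "y = smul k v" by (auto simp: span_singleton)
    then have "smul (inverse k) y = v" using y by auto
    with subspace_scale[OF sx y(1), of "inverse k"] v show False by simp
  qed
  with line[OF v] line[OF vy] that show thesis by blast
qed

text \<open>This separates an irreducible module with a type from all of \<Psi>, the value of the
  hull over an empty family. The indicator vectors of the two lines are independent and fixed by
  \<open>E_star smul x 0 1\<close>.\<close>

lemma supported_on_subspaces_not_has_type:
  assumes "vector_space smul" "vector_space.dim smul (UNIV :: 'v set) = N"
    and D: "D \<ge> 1" "N > D" and "x \<in> vertices smul D"
  shows "\<not> has_type smul N D x (supported_on (subspaces smul)) \<alpha> \<beta> \<rho>"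
proof
  let ?E = "(*v) (E_star smul x 0 1) ` supported_on (subspaces smul)"
  assume "has_type smul N D x (supported_on (subspaces smul)) \<alpha> \<beta> \<rho>"
  \<comment> \<open>The index (0, 1) is in range because D < N, and either branch of the type
    condition gives at most 1.\<close>
  then have dim: "vec.dim ?E \<le> 1"
    using D by (auto simp: has_type_def)
  obtain u u' where u: "u \<noteq> u'" "u \<in> location_class smul x 0 1" "u' \<in> location_class smul x 0 1"
    using two_points_outside_vertex[OF assms] .
  have ax: "axis v 1 \<in> ?E" if "v \<in> location_class smul x 0 1" for v
  proof (rule image_eqI)
    show "axis v 1 = E_star smul x 0 1 *v axis v 1"
      using that by (auto simp: vec_eq_iff E_star_def diag_on_mult_vec axis_def)
    show "axis v 1 \<in> supported_on (subspaces smul)"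
      using that by (auto simp: supported_on_def axis_def location_class_def)
  qed
  have ne: "axis u 1 \<noteq> (axis u' 1 :: 'v cvec)" using u(1) by (simp add: axis_eq_axis)
  have "vec.independent {axis u 1, axis u' 1 :: 'v cvec}"
    by (rule vec.independent_mono[OF independent_cart_basis]) (auto simp: cart_basis_def)
  then have "card {axis u 1, axis u' 1 :: 'v cvec} \<le> vec.dim ?E"
    using ax u by (intro vec.independent_card_le_dim) auto
  with dim ne show False by simp
qed

end

theorem lemma6p8:
  fixes smul :: "'a::{field,finite} \<Rightarrow> 'v::{ab_group_add,finite} \<Rightarrow> 'v"
    and N D r :: nat
    and x :: "'v set"
    and W \<Omega> :: "'v cvec set"
  assumes "vector_space smul"
    and "vector_space.dim smul (UNIV :: 'v set) = N"
    and "D \<ge> 1" and "N > 2 * D"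
    and "x \<in> vertices smul D"
    and "irreducible_T_module smul D x W"
    and "W \<subseteq> nucleus smul N D x"
    and "endpoint smul D x W = r"
    and "irreducible_H_module smul N D x \<Omega>"
    and "alpha_dominant smul N D x \<Omega> r"
  shows "tilde smul D x \<Omega> = W \<longleftrightarrow> \<Omega> = H_hull smul N D x W"
proof
  have W: "W \<subseteq> supported_on (vertices smul D)" "W \<noteq> {0}" "0 \<in> W"
    using assms(6)
    by (auto simp: irreducible_T_module_def irreducible_module_on_def module_on_def vec.subspace_0)
  have mod: "H_module smul N D x \<Omega>"
    using assms(9) by (simp add: irreducible_H_module_def irreducible_module_on_def H_module_def)
  then have supp: "\<Omega> \<subseteq> supported_on (subspaces smul)"
    by (simp add: H_module_def module_on_def)
  {
    assume tW: "tilde smul D x \<Omega> = W"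
    have "\<Omega> \<subseteq> \<Omega>'" if \<Omega>': "H_module smul N D x \<Omega>'" "tilde smul D x \<Omega>' = W" for \<Omega>'
    proof -
      have "W \<subseteq> \<Omega> \<inter> \<Omega>'"
        using tilde_subset[OF mod] tilde_subset[OF \<Omega>'(1)] tW \<Omega>'(2) by auto
      then have "\<Omega> \<inter> \<Omega>' \<noteq> {0}" using W by auto
      moreover have "module_on (subspaces smul) (H_algebra smul N D x) (\<Omega> \<inter> \<Omega>')"
        using mod \<Omega>'(1) by (auto simp: H_module_def intro: module_on_Int)
      ultimately have "\<Omega> \<inter> \<Omega>' = \<Omega>"
        using assms(9) unfolding irreducible_H_module_def irreducible_module_on_def by blast
      then show ?thesis by blast
    qed
    \<comment> \<open>The reverse inclusion holds because \<Omega> is itself a member of the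
      family.\<close>
    then show "\<Omega> = H_hull smul N D x W"
      using tW mod supp unfolding H_hull_def by blast
  }
  {
    assume hull: "\<Omega> = H_hull smul N D x W"
    have "\<Omega> \<noteq> supported_on (subspaces smul)"
      using supported_on_subspaces_not_has_type[of smul N D x r 0 0] assms
      by (auto simp: alpha_dominant_def)
    then obtain \<Omega>' where \<Omega>': "H_module smul N D x \<Omega>'" "tilde smul D x \<Omega>' = W"
      using hull unfolding H_hull_def by auto
    have "W \<subseteq> \<Omega>''" if "H_module smul N D x \<Omega>''" "tilde smul D x \<Omega>'' = W" for \<Omega>''
      using tilde_subset[OF that(1)] that(2) by simp
    \<comment> \<open>The hull is also intersected with \<Psi>, so \<open>W\<close> must be seen to
      lie there too.\<close>
    moreover have "W \<subseteq> supported_on (subspaces smul)"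
      using W(1) by (auto simp: supported_on_def vertices_def subspaces_def)
    ultimately have "W \<subseteq> \<Omega>"
      unfolding hull H_hull_def by auto
    then have "W \<subseteq> tilde smul D x \<Omega>"
      using subset_tilde assms(1,5) W(1) by blast
    moreover have "\<Omega> \<subseteq> \<Omega>'" using hull \<Omega>' unfolding H_hull_def by blast
    then have "tilde smul D x \<Omega> \<subseteq> W" using tilde_mono \<Omega>'(2) by blast
    ultimately show "tilde smul D x \<Omega> = W" by simp
  }
qed

end
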